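(* Let $n \ge 1$, $T \ge 1$ and $k \ge 2$ be integers, and let each customer $i \in \{1,\dots,n\}$ have a score $(R_i,F_i,M_i) \in \{1,\dots,T\}^3$. Let $G$ be the weighted customer graph built from these scores and let $G'$ be its reduced graph, with $n'$ vertices. Let $x_R^* \in \{0,1\}^{n'\times k}$ be an optimal solution of the max-$k$-cut problem (BQO) with input $G'$. Define $x^0 \in \{0,1\}^{n \times k}$ by $x^0_{il} = (x_R^* )_{pl}$ for every $l\in\{1,\dots,k\}$ whenever the vertex $i$ of $G$ has been merged into the vertex $p$ of $G'$. Then $x^0$ is an optimal solution of (BQO) with input $G$ (with the same $k$).
   Context: Customer graph $G$: $G=(V,E)$ is the simple weighted graph with vertex set $V=\{1,\dots,n\}$ (one vertex per customer). For vertices $i \neq j$ put $w_{ij} = |R_i-R_j| + |F_i-F_j| + |M_i-M_j|$. Vertices $i \ne j$ are joined by an edge $e_{ij}$, of weight $w_{ij}$, exactly when their scores differ (customers with the same score have $w_{ij}=0$ and are not joined by an edge). Problem (BQO): for a simple graph with vertices $1,\dots,n$, edge set $E$ and non-negative edge weights $w_{ij}$, and for an integer $k\ge 2$, maximize $$f(x) = \sum_{e_{ij}\in E} w_{ij}\left(1 - \sum_{l=1}^k x_{il}x_{jl}\right)$$ subject to $\sum_{l=1}^k x_{il} = 1$ for $i=1,\dots,n$ and $x_{il}\in\{0,1\}$ for all $i=1,\dots,n$, $l=1,\dots,k$. Each edge (unordered pair) is counted once. The variable $x_{il}$ equals $1$ iff vertex $i$ is assigned to group $V_l$; groups may be empty.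 Reduced graph $G'$: for each score that occurs among the customers, all vertices of $G$ with that score are merged into a single vertex of $G'$; thus the vertices of $G'$ are in bijection with the distinct scores occurring, and their number is $n' \le n$. If $p \ne q$ are vertices of $G'$ obtained by merging the sets $\{i_1,\dots,i_a\}$ and $\{j_1,\dots,j_b\}$ of vertices of $G$ respectively, then $p$ and $q$ are joined by an edge in $G'$ with weight $$w'_{pq} = \sum_{s=1}^{a}\sum_{r=1}^{b} w_{i_s j_r}.$$ (BQO) with input $G'$ is the problem of maximizing $$\sum_{\{p,q\}\in E(G')} w'_{pq}\left(1 - \sum_{l=1}^k y_{pl}y_{ql}\right)$$ over $y\in\{0,1\}^{n'\times k}$ subject to $\sum_{l=1}^k y_{pl} = 1$ for each of the $n'$ vertices $p$ of $G'$, where $E(G')$ is the edge set of $G'$ and each edge (unordered pair) is counted once. *)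

theory Defs
  imports Complex_Main
begin

text \<open>A weighted graph with vertices \<open>1, \<dots>, order G\<close>. Edges are two-element sets of vertices;
  the value \<open>weight G i j\<close> is relevant only if \<open>{i, j}\<close> is an edge.\<close>

record wgraph =
  order :: nat
  edges :: "nat set set"
  weight :: "nat \<Rightarrow> nat \<Rightarrow> real"

definition simple_wgraph :: "wgraph \<Rightarrow> bool" where
  "simple_wgraph G \<longleftrightarrow>
     (\<forall>e\<in>edges G. e \<subseteq> {1..order G} \<and> card e = 2) \<and>
     (\<forall>i j. {i, j} \<in> edges G \<longrightarrow> weight G i j = weight G j i \<and> 0 \<le> weight G i j)"

text \<open>The problem (BQO). Only the entries \<open>x i l\<close> with \<open>i \<in> {1..order G}\<close> and \<open>l \<in> {1..k}\<close> of the
  0/1 matrix matter. Each edge is represented in the objective by its pair \<open>(i, j)\<close> with \<open>i < j\<close>.\<close>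

definition bqo_feasible :: "wgraph \<Rightarrow> nat \<Rightarrow> (nat \<Rightarrow> nat \<Rightarrow> real) \<Rightarrow> bool" where
  "bqo_feasible G k x \<longleftrightarrow>
     (\<forall>i\<in>{1..order G}. \<forall>l\<in>{1..k}. x i l \<in> {0, 1}) \<and>
     (\<forall>i\<in>{1..order G}. (\<Sum>l=1..k. x i l) = 1)"

definition bqo_objective :: "wgraph \<Rightarrow> nat \<Rightarrow> (nat \<Rightarrow> nat \<Rightarrow> real) \<Rightarrow> real" where
  "bqo_objective G k x =
     (\<Sum>(i, j)\<in>{(i, j). i < j \<and> {i, j} \<in> edges G}.
        weight G i j * (1 - (\<Sum>l=1..k. x i l * x j l)))"

definition bqo_optimal :: "wgraph \<Rightarrow> nat \<Rightarrow> (nat \<Rightarrow> nat \<Rightarrow> real) \<Rightarrow> bool" where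
  "bqo_optimal G k x \<longleftrightarrow> is_arg_max (bqo_objective G k) (bqo_feasible G k) x"

definition score ::
  "(nat \<Rightarrow> nat) \<Rightarrow> (nat \<Rightarrow> nat) \<Rightarrow> (nat \<Rightarrow> nat) \<Rightarrow> nat \<Rightarrow> nat \<times> nat \<times> nat" where
  "score R F M i = (R i, F i, M i)"

definition customer_weight ::
  "(nat \<Rightarrow> nat) \<Rightarrow> (nat \<Rightarrow> nat) \<Rightarrow> (nat \<Rightarrow> nat) \<Rightarrow> nat \<Rightarrow> nat \<Rightarrow> real" where
  "customer_weight R F M i j =
     \<bar>real (R i) - real (R j)\<bar> + \<bar>real (F i) - real (F j)\<bar> + \<bar>real (M i) - real (M j)\<bar>"

definition customer_graph ::
  "nat \<Rightarrow> (nat \<Rightarrow> nat) \<Rightarrow> (nat \<Rightarrow> nat) \<Rightarrow> (nat \<Rightarrow> nat) \<Rightarrow> wgraph" where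
  "customer_graph n R F M =
     \<lparr>order = n,
      edges = {{i, j} | i j. i \<in> {1..n} \<and> j \<in> {1..n} \<and> i \<noteq> j \<and> score R F M i \<noteq> score R F M j},
      weight = customer_weight R F M\<rparr>"

text \<open>The vertices of the reduced graph are numbered \<open>1, \<dots>, n'\<close>, where \<open>n'\<close> is the number of
  distinct scores. The numbering is arbitrary: it is given by the map \<open>\<pi>\<close> sending each customer
  to the number of the vertex into which the customer is merged.\<close>

definition num_scores ::
  "nat \<Rightarrow> (nat \<Rightarrow> nat) \<Rightarrow> (nat \<Rightarrow> nat) \<Rightarrow> (nat \<Rightarrow> nat) \<Rightarrow> nat" where
  "num_scores n R F M = card (score R F M ` {1..n})"

definition merge_map ::
  "nat \<Rightarrow> (nat \<Rightarrow> nat) \<Rightarrow> (nat \<Rightarrow> nat) \<Rightarrow> (nat \<Rightarrow> nat) \<Rightarrow> (nat \<Rightarrow> nat) \<Rightarrow> bool" where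
  "merge_map n R F M \<pi> \<longleftrightarrow>
     \<pi> ` {1..n} = {1..num_scores n R F M} \<and>
     (\<forall>i\<in>{1..n}. \<forall>j\<in>{1..n}. \<pi> i = \<pi> j \<longleftrightarrow> score R F M i = score R F M j)"

definition reduced_graph ::
  "nat \<Rightarrow> (nat \<Rightarrow> nat) \<Rightarrow> (nat \<Rightarrow> nat) \<Rightarrow> (nat \<Rightarrow> nat) \<Rightarrow> (nat \<Rightarrow> nat) \<Rightarrow> wgraph" where
  "reduced_graph n R F M \<pi> =
     \<lparr>order = num_scores n R F M,
      edges = {{p, q} | p q. p \<in> {1..num_scores n R F M} \<and> q \<in> {1..num_scores n R F M} \<and> p \<noteq> q},
      weight = (\<lambda>p q. \<Sum>i\<in>{i \<in> {1..n}. \<pi> i = p}. \<Sum>j\<in>{j \<in> {1..n}. \<pi> j = q}.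
                  customer_weight R F M i j)\<rparr>"

lemma merge_map_exists: "\<exists>\<pi>. merge_map n R F M \<pi>"
proof -
  let ?S = "score R F M ` {1..n}"
  have "finite ?S" by simp
  then obtain h where h: "bij_betw h ?S {1..num_scores n R F M}"
    unfolding num_scores_def using ex_bij_betw_finite_nat[of ?S]
    by (metis finite_same_card_bij finite_atLeastAtMost card_atLeastAtMost diff_Suc_1)
  have "(\<lambda>i. h (score R F M i)) ` {1..n} = {1..num_scores n R F M}"
    using bij_betw_imp_surj_on[OF h] by (simp add: image_image)
  moreover have "h (score R F M i) = h (score R F M j) \<longleftrightarrow> score R F M i = score R F M j"
    if "i \<in> {1..n}" "j \<in> {1..n}" for i j
    using bij_betw_imp_inj_on[OF h] that by (auto dest: inj_onD)
  ultimately have "merge_map n R F M (\<lambda>i. h (score R F M i))"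
    unfolding merge_map_def by blast
  then show ?thesis by blast
qed

lemma customer_weight_commute: "customer_weight R F M i j = customer_weight R F M j i"
  by (simp add: customer_weight_def abs_minus_commute)

lemma customer_weight_nonneg: "0 \<le> customer_weight R F M i j"
  by (simp add: customer_weight_def)

lemma simple_customer_graph: "simple_wgraph (customer_graph n R F M)"
  unfolding simple_wgraph_def customer_graph_def
  by (auto simp: customer_weight_nonneg intro: customer_weight_commute)

lemma simple_reduced_graph: "simple_wgraph (reduced_graph n R F M \<pi>)"
proof -
  have "weight (reduced_graph n R F M \<pi>) p q = weight (reduced_graph n R F M \<pi>) q p" for p q
    unfolding reduced_graph_def
    by (simp, subst sum.swap) (simp add: customer_weight_commute)
  moreover have "0 \<le> weight (reduced_graph n R F M \<pi>) p q" for p q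
    unfolding reduced_graph_def by (simp add: sum_nonneg customer_weight_nonneg)
  moreover have "e \<subseteq> {1..order (reduced_graph n R F M \<pi>)} \<and> card e = 2"
    if "e \<in> edges (reduced_graph n R F M \<pi>)" for e
    using that unfolding reduced_graph_def by auto
  ultimately show ?thesis
    unfolding simple_wgraph_def by blast
qed

end

theory Submission
  imports Defs
begin

text \<open>
  A solution \<open>y\<close> of the reduced problem, copied to all customers of each merged class, has the same
  objective value in the customer graph: an edge of the reduced graph carries exactly the total
  weight between its two classes, and customers of the same class are at weight \<open>0\<close>
  (\<open>bqo_objective_lift\<close>). It remains to see that no solution \<open>x\<close> of the customer problem beats all
  solutions that are constant on classes.

  For this, let \<open>C\<close> be a class and freeze \<open>x\<close> outside \<open>C\<close>. No weight joins two members of \<open>C\<close>, and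
  all of them have the same weights to the outside, so the objective is a constant plus
  \<open>\<Sum>i\<in>C. g (x i)\<close> with one and the same function \<open>g\<close> for all members. Hence moving the whole class
  to the group of a member with the largest value of \<open>g\<close> does not decrease the objective. Doing so
  class after class (\<open>class_representatives\<close>) produces one representative per class, and the
  groups of the representatives form a feasible solution of the reduced problem that is at least
  as good as \<open>x\<close> (\<open>reduced_solution_dominates\<close>).

  Throughout, twice the objective is written as a sum over all ordered pairs of vertices
  (\<open>bqo_objective_double\<close>); this sum does not depend on the order of the vertex numbers, which
  merging does not respect.
\<close>

section \<open>Collapsing classes to representatives\<close>

text \<open>One class at a time: \<open>s\<close> records which customer's group each customer currently uses, and
  \<open>S\<close> is the set of classes already collapsed. The part of the sum that involves the class of \<open>p\<close>
  is a sum over its members of the same function of the customer whose group is used, so it is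
  largest when all members use the customer that maximizes this function.\<close>

lemma collapse_classes:
  fixes w :: "'b \<Rightarrow> 'b \<Rightarrow> real" and d :: "'a \<Rightarrow> 'a \<Rightarrow> real" and \<kappa> :: "'a \<Rightarrow> 'b"
  assumes V: "finite V"
    and w_sym: "\<And>a b. w a b = w b a" and w_diag: "\<And>a. w a a = 0"
    and d_sym: "\<And>i j. d i j = d j i"
    and S: "finite S" "S \<subseteq> \<kappa> ` V"
  shows "\<exists>s. (\<forall>i\<in>V. s i \<in> V \<and> \<kappa> (s i) = \<kappa> i) \<and>
             (\<forall>i\<in>V. \<forall>j\<in>V. \<kappa> i = \<kappa> j \<longrightarrow> \<kappa> i \<in> S \<longrightarrow> s i = s j) \<and>
             (\<Sum>i\<in>V. \<Sum>j\<in>V. w (\<kappa> i) (\<kappa> j) * d i j)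
               \<le> (\<Sum>i\<in>V. \<Sum>j\<in>V. w (\<kappa> i) (\<kappa> j) * d (s i) (s j))"
  using S
proof (induction S rule: finite_induct)
  case empty
  show ?case by (rule exI[of _ id]) simp
next
  case (insert p S)
  then obtain s where s_class: "\<forall>i\<in>V. s i \<in> V \<and> \<kappa> (s i) = \<kappa> i"
    and s_const: "\<forall>i\<in>V. \<forall>j\<in>V. \<kappa> i = \<kappa> j \<longrightarrow> \<kappa> i \<in> S \<longrightarrow> s i = s j"
    and s_ge: "(\<Sum>i\<in>V. \<Sum>j\<in>V. w (\<kappa> i) (\<kappa> j) * d i j)
               \<le> (\<Sum>i\<in>V. \<Sum>j\<in>V. w (\<kappa> i) (\<kappa> j) * d (s i) (s j))"
    by auto
  define C where "C = {i \<in> V. \<kappa> i = p}"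
  define D where "D = {i \<in> V. \<kappa> i \<noteq> p}"
  define g where "g i = (\<Sum>j\<in>D. w p (\<kappa> j) * d i (s j))" for i
  have fin: "finite C" "finite D" and V_eq: "V = C \<union> D" and disj: "C \<inter> D = {}"
    using V by (auto simp: C_def D_def)
  have "C \<noteq> {}" using insert.prems by (auto simp: C_def)
  then have "Max (g ` C) \<in> g ` C" using fin(1) by simp
  then obtain c where c: "c \<in> C" and c_Max: "g c = Max (g ` C)" by force
  have c_max: "g i \<le> g c" if "i \<in> C" for i
    using that fin(1) by (simp add: c_Max)
  define s' where "s' i = (if i \<in> C then c else s i)" for i
  have split: "(\<Sum>i\<in>V. \<Sum>j\<in>V. w (\<kappa> i) (\<kappa> j) * d (t i) (t j))
      = (\<Sum>i\<in>D. \<Sum>j\<in>D. w (\<kappa> i) (\<kappa> j) * d (s i) (s j)) + 2 * (\<Sum>i\<in>C. g (t i))"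
    if t: "\<And>j. j \<in> D \<Longrightarrow> t j = s j" for t
  proof -
    have CC: "(\<Sum>i\<in>C. \<Sum>j\<in>C. w (\<kappa> i) (\<kappa> j) * d (t i) (t j)) = 0"
      by (simp add: C_def w_diag)
    have CD: "(\<Sum>i\<in>C. \<Sum>j\<in>D. w (\<kappa> i) (\<kappa> j) * d (t i) (t j)) = (\<Sum>i\<in>C. g (t i))"
      by (intro sum.cong refl) (simp add: g_def C_def t)
    have DC: "(\<Sum>i\<in>D. \<Sum>j\<in>C. w (\<kappa> i) (\<kappa> j) * d (t i) (t j))
        = (\<Sum>i\<in>C. \<Sum>j\<in>D. w (\<kappa> i) (\<kappa> j) * d (t i) (t j))"
      by (subst sum.swap) (intro sum.cong refl arg_cong2[where f = times] w_sym d_sym)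
    have DD: "(\<Sum>i\<in>D. \<Sum>j\<in>D. w (\<kappa> i) (\<kappa> j) * d (t i) (t j))
        = (\<Sum>i\<in>D. \<Sum>j\<in>D. w (\<kappa> i) (\<kappa> j) * d (s i) (s j))"
      by (simp add: t)
    show ?thesis
      unfolding V_eq using fin disj CC CD DC DD
      by (simp add: sum.union_disjoint sum.distrib)
  qed
  have "(\<Sum>i\<in>C. g (s i)) \<le> (\<Sum>i\<in>C. g (s' i))"
    using c_max s_class by (intro sum_mono) (auto simp: s'_def C_def)
  moreover have "s' j = s j" if "j \<in> D" for j
    using that disj by (auto simp: s'_def)
  ultimately have "(\<Sum>i\<in>V. \<Sum>j\<in>V. w (\<kappa> i) (\<kappa> j) * d (s i) (s j))
      \<le> (\<Sum>i\<in>V. \<Sum>j\<in>V. w (\<kappa> i) (\<kappa> j) * d (s' i) (s' j))"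
    by (simp add: split)
  with s_ge have "(\<Sum>i\<in>V. \<Sum>j\<in>V. w (\<kappa> i) (\<kappa> j) * d i j)
      \<le> (\<Sum>i\<in>V. \<Sum>j\<in>V. w (\<kappa> i) (\<kappa> j) * d (s' i) (s' j))"
    by linarith
  moreover have "\<forall>i\<in>V. s' i \<in> V \<and> \<kappa> (s' i) = \<kappa> i"
    using s_class c by (auto simp: s'_def C_def)
  moreover have "\<forall>i\<in>V. \<forall>j\<in>V. \<kappa> i = \<kappa> j \<longrightarrow> \<kappa> i \<in> insert p S \<longrightarrow> s' i = s' j"
  proof (intro ballI impI)
    fix i j assume ij: "i \<in> V" "j \<in> V" "\<kappa> i = \<kappa> j" "\<kappa> i \<in> insert p S"
    show "s' i = s' j"
    proof (cases "\<kappa> i = p")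
      case True
      then show ?thesis using ij(1-3) by (simp add: s'_def C_def)
    next
      case False
      then have "s i = s j" using s_const ij by blast
      with False show ?thesis using ij(3) by (simp add: s'_def C_def)
    qed
  qed
  ultimately show ?case by blast
qed

lemma class_representatives:
  fixes w :: "'b \<Rightarrow> 'b \<Rightarrow> real" and d :: "'a \<Rightarrow> 'a \<Rightarrow> real" and \<kappa> :: "'a \<Rightarrow> 'b"
  assumes V: "finite V"
    and w_sym: "\<And>a b. w a b = w b a" and w_diag: "\<And>a. w a a = 0"
    and d_sym: "\<And>i j. d i j = d j i"
  obtains r where "\<And>a. a \<in> \<kappa> ` V \<Longrightarrow> r a \<in> V"
    and "(\<Sum>i\<in>V. \<Sum>j\<in>V. w (\<kappa> i) (\<kappa> j) * d i j)
          \<le> (\<Sum>i\<in>V. \<Sum>j\<in>V. w (\<kappa> i) (\<kappa> j) * d (r (\<kappa> i)) (r (\<kappa> j)))"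
proof -
  obtain s where s_class: "\<forall>i\<in>V. s i \<in> V \<and> \<kappa> (s i) = \<kappa> i"
    and s_const: "\<forall>i\<in>V. \<forall>j\<in>V. \<kappa> i = \<kappa> j \<longrightarrow> \<kappa> i \<in> \<kappa> ` V \<longrightarrow> s i = s j"
    and s_ge: "(\<Sum>i\<in>V. \<Sum>j\<in>V. w (\<kappa> i) (\<kappa> j) * d i j)
               \<le> (\<Sum>i\<in>V. \<Sum>j\<in>V. w (\<kappa> i) (\<kappa> j) * d (s i) (s j))"
    using collapse_classes[of V w d "\<kappa> ` V" \<kappa>] V w_sym w_diag d_sym by blast
  define r where "r a = s (inv_into V \<kappa> a)" for a
  have r: "r (\<kappa> i) = s i" if "i \<in> V" for i
    using that s_const unfolding r_def by (metis f_inv_into_f imageI inv_into_into)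
  show thesis
  proof
    show "r a \<in> V" if "a \<in> \<kappa> ` V" for a
      using that s_class by (auto simp: r)
    show "(\<Sum>i\<in>V. \<Sum>j\<in>V. w (\<kappa> i) (\<kappa> j) * d i j)
          \<le> (\<Sum>i\<in>V. \<Sum>j\<in>V. w (\<kappa> i) (\<kappa> j) * d (r (\<kappa> i)) (r (\<kappa> j)))"
      using s_ge by (simp add: r)
  qed
qed

section \<open>The objective as a sum over ordered pairs\<close>

lemma sum_ordered_pairs_eq_double:
  fixes c :: "nat \<Rightarrow> nat \<Rightarrow> real"
  assumes A: "finite A"
    and sym: "\<And>i j. i \<in> A \<Longrightarrow> j \<in> A \<Longrightarrow> c i j = c j i"
    and diag: "\<And>i. i \<in> A \<Longrightarrow> c i i = 0"
  shows "(\<Sum>i\<in>A. \<Sum>j\<in>A. c i j) = 2 * (\<Sum>(i, j)\<in>{(i, j). i \<in> A \<and> j \<in> A \<and> i < j}. c i j)"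
proof -
  let ?L = "{(i, j). i \<in> A \<and> j \<in> A \<and> i < j}" and ?G = "{(i, j). i \<in> A \<and> j \<in> A \<and> j < i}"
  have fin: "finite ?L" "finite ?G"
    by (rule finite_subset[of _ "A \<times> A"]; use A in auto)+
  have "(\<Sum>i\<in>A. \<Sum>j\<in>A. c i j) = (\<Sum>(i, j)\<in>A \<times> A. c i j)"
    by (rule sum.cartesian_product)
  also have "\<dots> = (\<Sum>(i, j)\<in>?L \<union> ?G. c i j)"
  proof (rule sum.mono_neutral_right)
    show "\<forall>e\<in>A \<times> A - (?L \<union> ?G). (case e of (i, j) \<Rightarrow> c i j) = 0"
    proof
      fix e assume e: "e \<in> A \<times> A - (?L \<union> ?G)"
      obtain i j where "e = (i, j)" by fastforce
      with e have "i \<in> A" "i = j" by auto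
      with \<open>e = (i, j)\<close> diag show "(case e of (i, j) \<Rightarrow> c i j) = 0" by simp
    qed
  qed (use A in auto)
  also have "\<dots> = (\<Sum>(i, j)\<in>?L. c i j) + (\<Sum>(i, j)\<in>?G. c i j)"
    using fin by (intro sum.union_disjoint) auto
  also have "(\<Sum>(i, j)\<in>?G. c i j) = (\<Sum>(i, j)\<in>?L. c i j)"
    by (rule sum.reindex_bij_witness[where i = "\<lambda>(i, j). (j, i)" and j = "\<lambda>(i, j). (j, i)"])
      (auto intro: sym)
  finally show ?thesis by simp
qed

lemma bqo_objective_double:
  assumes simple: "simple_wgraph G"
    and nonedge: "\<And>i j. i \<in> {1..order G} \<Longrightarrow> j \<in> {1..order G} \<Longrightarrow> {i, j} \<notin> edges G
                    \<Longrightarrow> weight G i j = 0"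
  shows "2 * bqo_objective G k x =
    (\<Sum>i=1..order G. \<Sum>j=1..order G. weight G i j * (1 - (\<Sum>l=1..k. x i l * x j l)))"
proof -
  let ?A = "{1..order G}"
  define c where "c i j = weight G i j * (1 - (\<Sum>l=1..k. x i l * x j l))" for i j
  have edge: "i \<in> ?A \<and> j \<in> ?A \<and> i \<noteq> j" if "{i, j} \<in> edges G" for i j
    using simple that unfolding simple_wgraph_def by (force simp: card_insert_if)
  have sym: "c i j = c j i" if "i \<in> ?A" "j \<in> ?A" for i j
  proof -
    have "weight G i j = weight G j i"
      using simple nonedge[OF that] nonedge[OF that(2) that(1)]
      unfolding simple_wgraph_def by (metis insert_commute)
    then show ?thesis by (simp add: c_def mult.commute)
  qed
  have diag: "c i i = 0" if "i \<in> ?A" for i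
    using nonedge[OF that that] edge[of i i] by (auto simp: c_def)
  have "bqo_objective G k x = (\<Sum>(i, j)\<in>{(i, j). i < j \<and> {i, j} \<in> edges G}. c i j)"
    by (simp add: bqo_objective_def c_def)
  also have "\<dots> = (\<Sum>(i, j)\<in>{(i, j). i \<in> ?A \<and> j \<in> ?A \<and> i < j}. c i j)"
  proof (rule sum.mono_neutral_left)
    show "finite {(i, j). i \<in> ?A \<and> j \<in> ?A \<and> i < j}"
      by (rule finite_subset[of _ "?A \<times> ?A"]) auto
    show "{(i, j). i < j \<and> {i, j} \<in> edges G} \<subseteq> {(i, j). i \<in> ?A \<and> j \<in> ?A \<and> i < j}"
      using edge by blast
    show "\<forall>e\<in>{(i, j). i \<in> ?A \<and> j \<in> ?A \<and> i < j} - {(i, j). i < j \<and> {i, j} \<in> edges G}.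
        (case e of (i, j) \<Rightarrow> c i j) = 0"
      unfolding c_def using nonedge by fastforce
  qed
  finally show ?thesis
    using sum_ordered_pairs_eq_double[of ?A c] sym diag by (simp add: c_def)
qed

section \<open>Customer graph and reduced graph\<close>

lemma customer_weight_same_score:
  "score R F M i = score R F M j \<Longrightarrow> customer_weight R F M i j = 0"
  by (simp add: score_def customer_weight_def)

lemma customer_objective_double:
  "2 * bqo_objective (customer_graph n R F M) k x =
    (\<Sum>i=1..n. \<Sum>j=1..n. customer_weight R F M i j * (1 - (\<Sum>l=1..k. x i l * x j l)))"
proof -
  have "customer_weight R F M i j = 0"
    if "i \<in> {1..n}" "j \<in> {1..n}" "{i, j} \<notin> edges (customer_graph n R F M)" for i j
    using that by (intro customer_weight_same_score) (auto simp: customer_graph_def)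
  then show ?thesis
    using bqo_objective_double[OF simple_customer_graph[of n R F M], of k x]
    by (simp add: customer_graph_def)
qed

lemma reduced_objective_double:
  assumes \<pi>: "merge_map n R F M \<pi>"
  shows "2 * bqo_objective (reduced_graph n R F M \<pi>) k y =
    (\<Sum>i=1..n. \<Sum>j=1..n. customer_weight R F M i j * (1 - (\<Sum>l=1..k. y (\<pi> i) l * y (\<pi> j) l)))"
proof -
  let ?G = "reduced_graph n R F M \<pi>" and ?N = "num_scores n R F M"
  let ?cls = "\<lambda>p. {i \<in> {1..n}. \<pi> i = p}"
  define h where "h p q = 1 - (\<Sum>l=1..k. y p l * y q l)" for p q
  have \<pi>_img: "\<pi> ` {1..n} \<subseteq> {1..?N}"
    using \<pi> by (simp add: merge_map_def)
  have \<pi>_eq: "score R F M i = score R F M j" if "i \<in> {1..n}" "j \<in> {1..n}" "\<pi> i = \<pi> j" for i j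
    using \<pi> that unfolding merge_map_def by blast
  have nonedge: "weight ?G p q = 0"
    if "p \<in> {1..order ?G}" "q \<in> {1..order ?G}" "{p, q} \<notin> edges ?G" for p q
  proof -
    have "p = q" using that by (auto simp: reduced_graph_def)
    then show ?thesis
      by (auto simp: reduced_graph_def intro!: sum.neutral customer_weight_same_score \<pi>_eq)
  qed
  have "2 * bqo_objective ?G k y = (\<Sum>p=1..?N. \<Sum>q=1..?N. weight ?G p q * h p q)"
    using bqo_objective_double[OF simple_reduced_graph nonedge, of k y]
    by (simp add: h_def) (simp add: reduced_graph_def)
  also have "\<dots> = (\<Sum>p=1..?N. \<Sum>q=1..?N. \<Sum>i\<in>?cls p. \<Sum>j\<in>?cls q.
      customer_weight R F M i j * h (\<pi> i) (\<pi> j))"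
    by (simp add: reduced_graph_def sum_distrib_right)
  also have "\<dots> = (\<Sum>p=1..?N. \<Sum>i\<in>?cls p. \<Sum>q=1..?N. \<Sum>j\<in>?cls q.
      customer_weight R F M i j * h (\<pi> i) (\<pi> j))"
    by (intro sum.cong refl sum.swap)
  also have "\<dots> = (\<Sum>p=1..?N. \<Sum>i\<in>?cls p. \<Sum>j=1..n.
      customer_weight R F M i j * h (\<pi> i) (\<pi> j))"
    by (intro sum.cong refl sum.group) (use \<pi>_img in auto)
  also have "\<dots> = (\<Sum>i=1..n. \<Sum>j=1..n. customer_weight R F M i j * h (\<pi> i) (\<pi> j))"
    by (intro sum.group) (use \<pi>_img in auto)
  finally show ?thesis by (simp add: h_def)
qed

lemma bqo_objective_lift:
  assumes \<pi>: "merge_map n R F M \<pi>"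
    and lift: "\<forall>i\<in>{1..n}. \<forall>l\<in>{1..k}. x i l = y (\<pi> i) l"
  shows "bqo_objective (customer_graph n R F M) k x = bqo_objective (reduced_graph n R F M \<pi>) k y"
proof -
  have "2 * bqo_objective (customer_graph n R F M) k x
      = 2 * bqo_objective (reduced_graph n R F M \<pi>) k y"
    unfolding customer_objective_double reduced_objective_double[OF \<pi>]
    using lift by (intro sum.cong refl arg_cong2[where f = times] arg_cong2[where f = minus]) auto
  then show ?thesis by simp
qed

lemma bqo_feasible_lift:
  assumes \<pi>: "merge_map n R F M \<pi>"
    and lift: "\<forall>i\<in>{1..n}. \<forall>l\<in>{1..k}. x i l = y (\<pi> i) l"
    and y: "bqo_feasible (reduced_graph n R F M \<pi>) k y"
  shows "bqo_feasible (customer_graph n R F M) k x"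
proof -
  have "\<pi> i \<in> {1..num_scores n R F M}" if "i \<in> {1..n}" for i
    using \<pi> that unfolding merge_map_def by blast
  then show ?thesis
    using lift y by (simp add: bqo_feasible_def customer_graph_def reduced_graph_def)
qed

lemma reduced_solution_dominates:
  assumes \<pi>: "merge_map n R F M \<pi>"
    and x: "bqo_feasible (customer_graph n R F M) k x"
  obtains y where "bqo_feasible (reduced_graph n R F M \<pi>) k y"
    and "bqo_objective (customer_graph n R F M) k x \<le> bqo_objective (reduced_graph n R F M \<pi>) k y"
proof -
  let ?V = "{1..n}"
  \<comment> \<open>A customer weight depends only on the two scores, hence only on the two merged vertices;
      \<open>w\<close> is this weight between classes, as opposed to the total weight in the reduced graph.\<close>
  define rep where "rep = inv_into ?V \<pi>"
  define w where "w p q = customer_weight R F M (rep p) (rep q)" for p q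
  define d where "d i j = 1 - (\<Sum>l=1..k. x i l * x j l)" for i j
  have rep: "score R F M (rep (\<pi> i)) = score R F M i" if "i \<in> ?V" for i
  proof -
    have "rep (\<pi> i) \<in> ?V" "\<pi> (rep (\<pi> i)) = \<pi> i"
      unfolding rep_def using that by (blast intro: inv_into_into f_inv_into_f)+
    then show ?thesis
      using \<pi> that unfolding merge_map_def by blast
  qed
  have w: "w (\<pi> i) (\<pi> j) = customer_weight R F M i j" if "i \<in> ?V" "j \<in> ?V" for i j
    using rep[OF that(1)] rep[OF that(2)] by (simp add: w_def score_def customer_weight_def)
  have w_sym: "w p q = w q p" for p q
    by (simp add: w_def customer_weight_commute)
  have w_diag: "w p p = 0" for p
    by (simp add: w_def customer_weight_same_score)
  have d_sym: "d i j = d j i" for i j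
    by (simp add: d_def mult.commute)
  obtain r where r: "\<And>p. p \<in> \<pi> ` ?V \<Longrightarrow> r p \<in> ?V"
    and r_ge: "(\<Sum>i\<in>?V. \<Sum>j\<in>?V. w (\<pi> i) (\<pi> j) * d i j)
          \<le> (\<Sum>i\<in>?V. \<Sum>j\<in>?V. w (\<pi> i) (\<pi> j) * d (r (\<pi> i)) (r (\<pi> j)))"
    using class_representatives[of ?V w d \<pi>] w_sym w_diag d_sym by blast
  show thesis
  proof
    show "bqo_feasible (reduced_graph n R F M \<pi>) k (\<lambda>p. x (r p))"
      using x r \<pi> by (simp add: bqo_feasible_def customer_graph_def reduced_graph_def merge_map_def)
    have "2 * bqo_objective (customer_graph n R F M) k x
        \<le> 2 * bqo_objective (reduced_graph n R F M \<pi>) k (\<lambda>p. x (r p))"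
      using r_ge unfolding customer_objective_double reduced_objective_double[OF \<pi>]
      by (simp add: w d_def)
    then show "bqo_objective (customer_graph n R F M) k x
        \<le> bqo_objective (reduced_graph n R F M \<pi>) k (\<lambda>p. x (r p))"
      by simp
  qed
qed

theorem mainTheorem3:
  fixes n T k :: nat
    and R F M :: "nat \<Rightarrow> nat"
    and \<pi> :: "nat \<Rightarrow> nat"
    and xR x0 :: "nat \<Rightarrow> nat \<Rightarrow> real"
  assumes "n \<ge> 1" and "T \<ge> 1" and "k \<ge> 2"
    and "\<forall>i\<in>{1..n}. R i \<in> {1..T} \<and> F i \<in> {1..T} \<and> M i \<in> {1..T}"
    and "merge_map n R F M \<pi>"
    and "bqo_optimal (reduced_graph n R F M \<pi>) k xR"
    and "\<forall>i\<in>{1..n}. \<forall>l\<in>{1..k}. x0 i l = xR (\<pi> i) l"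
  shows "bqo_optimal (customer_graph n R F M) k x0"
proof -
  let ?G = "customer_graph n R F M" and ?G' = "reduced_graph n R F M \<pi>"
  have xR: "bqo_feasible ?G' k xR"
    and xR_max: "\<And>y. bqo_feasible ?G' k y \<Longrightarrow> bqo_objective ?G' k y \<le> bqo_objective ?G' k xR"
    using assms(6) by (auto simp: bqo_optimal_def is_arg_max_linorder)
  have "bqo_objective ?G k x \<le> bqo_objective ?G k x0" if x: "bqo_feasible ?G k x" for x
  proof -
    obtain y where "bqo_feasible ?G' k y" "bqo_objective ?G k x \<le> bqo_objective ?G' k y"
      using reduced_solution_dominates[OF assms(5) x] .
    with xR_max show ?thesis
      unfolding bqo_objective_lift[OF assms(5) assms(7)] by force
  qed
  moreover have "bqo_feasible ?G k x0"
    using bqo_feasible_lift[OF assms(5) assms(7) xR] .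
  ultimately show ?thesis
    by (auto simp: bqo_optimal_def is_arg_max_linorder)
qed

end
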